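(* Let $n,K\ge 1$ be integers, let $\Sigma$ be a finite set of modes, and for each $\mathsf{a}\in\Sigma$ let $A^0_{\mathsf a},A^1_{\mathsf a}\in(\mathbb{R}\cup\{-\infty\})^{n\times n}$ and $B^0_{\mathsf a},B^1_{\mathsf a}\in(\mathbb{R}\cup\{+\infty\})^{n\times n}$. Let $v=(v_1,\dots,v_K)$ be a fixed sequence with $v_k\in\Sigma$. Assume that the system is a permutation flow shop, i.e. $(A^0_{v_k})_{i+1,i}\ge 0$ for all $i\in\{1,\dots,n-1\}$, $k\in\{1,\dots,K\}$, and $(A^1_{v_k})_{i,i}\ge 0$ for all $i\in\{1,\dots,n\}$, $k\in\{1,\dots,K-1\}$. Consider the makespan problem $$\min_{x(1),\dots,x(K)\in\mathbb{R}^n}\ x_n(K)-x_1(1)$$ subject to $$A^0_{v_k}\otimes x(k)\preceq x(k)\preceq B^0_{v_k}\boxtimes x(k)\quad\text{for all }k\in\{1,\dots,K\},$$ $$A^1_{v_k}\otimes x(k)\preceq x(k+1)\preceq B^1_{v_k}\boxtimes x(k)\quad\text{for all }k\in\{1,\dots,K-1\}.$$ With the matrices $C_k,\mathbb{P}_k,\mathbb{I}_k,\mathbb{C}_k$ defined in the context, a solution of this problem exists (i.e. the constraints are feasible and the minimum is attained) if and only if $\mathcal{G}(C_k)\in\Gamma$ for all $k\in\{1,\dots,K\}$ and $\mathcal{G}(\mathbb{C}_k)\in\Gamma$ for all $k\in\{1,\dots,K-1\}$. If these conditions hold and $K\ge 2$, then the makespan (the optimal value of the problem) equals the entry $(n,1)$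 of the matrix $$\mathbb{M}=\mathbb{I}_{K-1}\otimes\mathbb{C}_{K-1}^*\otimes\mathbb{I}_{K-2}\otimes\mathbb{C}_{K-2}^*\otimes\cdots\otimes\mathbb{I}_1\otimes\mathbb{C}_1^*.$$
   Context: Max-plus algebra: on $\overline{\mathbb{R}}=\mathbb{R}\cup\{\pm\infty\}$, $a\oplus b=\max(a,b)$; $a\otimes b=a+b$ if $a,b\ne-\infty$ and $a\otimes b=-\infty$ otherwise; $a\boxplus b=\min(a,b)$; $a\boxtimes b=a+b$ if $a,b\neq+\infty$ and $a\boxtimes b=+\infty$ otherwise. For matrices: $(A\oplus B)_{ij}=A_{ij}\oplus B_{ij}$, $(A\otimes C)_{ih}=\max_k (A_{ik}\otimes C_{kh})$, $(A\boxtimes C)_{ih}=\min_k (A_{ik}\boxtimes C_{kh})$. $A\preceq B$ means $A_{ij}\le B_{ij}$ for all $i,j$. $E_\otimes$ is the matrix with $0$ on the diagonal and $-\infty$ elsewhere; $A^0=E_\otimes$, $A^r=A^{r-1}\otimes A$, and the Kleene star is $A^*=\bigoplus_{r\ge 0}A^r$ (entrywise supremum in $\overline{\mathbb{R}}$). (The superscripts in $A^0_{\mathsf a},A^1_{\mathsf a},B^0_{\mathsf a},B^1_{\mathsf a}$ are labels, not powers.) $A^\sharp=-A^\top$, and $B^{0\sharp}_{\mathsf a}=(B^0_{\mathsf a})^\sharp$, $B^{1\sharp}_{\mathsf a}=(B^1_{\mathsf a})^\sharp$. Precedence graph: for a square matrix $A$ of size $n$, $\mathcal{G}(A)$ is the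 weighted directed graph with nodes $\{1,\dots,n\}$ and an arc from $j$ to $i$ of weight $A_{ij}$ if and only if $A_{ij}\ne-\infty$ (should a matrix have entries $+\infty$, arcs of weight $+\infty$ are allowed). The weight of a path is the sum of the weights of its arcs; a circuit is a path whose first and last nodes coincide. $\Gamma$ is the set of precedence graphs having no circuit of positive weight. Matrices: $C_k=A^0_{v_k}\oplus B^{0\sharp}_{v_k}$ for $k\in\{1,\dots,K\}$; $I_k=A^1_{v_k}$ and $P_k=B^{1\sharp}_{v_k}$ for $k\in\{1,\dots,K-1\}$. For $k\in\{1,\dots,K-1\}$, $\mathbb{P}_k=C_k^*\otimes P_k\otimes C_{k+1}^*$ and $\mathbb{I}_k=C_{k+1}^*\otimes I_k\otimes C_k^*$. The matrices $\mathbb{C}_k$ are $$\mathbb{C}_k=\mathbb{P}_k(\mathbb{P}_{k+1}(\cdots(\mathbb{P}_{K-1}\mathbb{I}_{K-1})^*\cdots)^*\mathbb{I}_{k+1})^*\mathbb{I}_k$$ (products are $\otimes$), i.e. $\mathbb{C}_{K-1}=\mathbb{P}_{K-1}\otimes\mathbb{I}_{K-1}$ and $\mathbb{C}_k=\mathbb{P}_k\otimes\mathbb{C}_{k+1}^*\otimes\mathbb{I}_k$ for $k\in\{1,\dots,K-2\}$. *)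

theory Defs
  imports "HOL-Library.Extended_Real" "Graph_Theory.Arc_Walk"
begin

text \<open>
  A matrix of size \<open>n \<times> n\<close> is a function of the row and the column index of which only
  the values at indices in \<open>{1..n}\<close> matter; likewise for vectors.
\<close>

type_synonym ematrix = "nat \<Rightarrow> nat \<Rightarrow> ereal"
type_synonym evector = "nat \<Rightarrow> ereal"

text \<open>
  The two scalar products differ only on infinities of opposite signs. Plain addition on
  \<^typ>\<open>ereal\<close> yields \<open>\<infinity>\<close> there, so it is not the max-plus product.
\<close>

definition otimes :: "ereal \<Rightarrow> ereal \<Rightarrow> ereal"  (infixl "\<otimes>\<^sub>s" 70) where
  "a \<otimes>\<^sub>s b = (if a \<noteq> -\<infinity> \<and> b \<noteq> -\<infinity> then a + b else -\<infinity>)"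

definition boxtimes :: "ereal \<Rightarrow> ereal \<Rightarrow> ereal"  (infixl "\<boxtimes>\<^sub>s" 70) where
  "a \<boxtimes>\<^sub>s b = (if a \<noteq> \<infinity> \<and> b \<noteq> \<infinity> then a + b else \<infinity>)"

definition mat_oplus :: "ematrix \<Rightarrow> ematrix \<Rightarrow> ematrix"  (infixl "\<oplus>\<^sub>m" 65) where
  "A \<oplus>\<^sub>m B = (\<lambda>i j. max (A i j) (B i j))"

definition mat_otimes :: "ematrix \<Rightarrow> nat \<Rightarrow> ematrix \<Rightarrow> ematrix"  ("(_ \<otimes>[_]/ _)" [70, 0, 71] 70) where
  "A \<otimes>[n] B = (\<lambda>i h. MAX k\<in>{1..n}. A i k \<otimes>\<^sub>s B k h)"

definition mat_vec_otimes :: "nat \<Rightarrow> ematrix \<Rightarrow> evector \<Rightarrow> evector" where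
  "mat_vec_otimes n A x = (\<lambda>i. MAX k\<in>{1..n}. A i k \<otimes>\<^sub>s x k)"

definition mat_vec_boxtimes :: "nat \<Rightarrow> ematrix \<Rightarrow> evector \<Rightarrow> evector" where
  "mat_vec_boxtimes n A x = (\<lambda>i. MIN k\<in>{1..n}. A i k \<boxtimes>\<^sub>s x k)"

definition vec_le :: "nat \<Rightarrow> evector \<Rightarrow> evector \<Rightarrow> bool" where
  "vec_le n x y \<longleftrightarrow> (\<forall>i\<in>{1..n}. x i \<le> y i)"

definition mat_sharp :: "ematrix \<Rightarrow> ematrix" where
  "mat_sharp A = (\<lambda>i j. - A j i)"

definition mat_E :: ematrix where
  "mat_E = (\<lambda>i j. if i = j then 0 else -\<infinity>)"

primrec mat_power :: "nat \<Rightarrow> ematrix \<Rightarrow> nat \<Rightarrow> ematrix" where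
  "mat_power n A 0 = mat_E"
| "mat_power n A (Suc r) = mat_power n A r \<otimes>[n] A"

definition mat_star :: "nat \<Rightarrow> ematrix \<Rightarrow> ematrix" where
  "mat_star n A = (\<lambda>i j. SUP r. mat_power n A r i j)"


text \<open>
  An arc is the pair (source, target); the arc \<open>(j, i)\<close> carries the weight \<open>A i j\<close>.
\<close>

type_synonym weighted_graph = "(nat, nat \<times> nat) pre_digraph \<times> (nat \<times> nat \<Rightarrow> ereal)"

definition precedence_graph :: "nat \<Rightarrow> ematrix \<Rightarrow> weighted_graph" where
  "precedence_graph n A =
     (\<lparr>verts = {1..n},
       arcs = {(j, i). j \<in> {1..n} \<and> i \<in> {1..n} \<and> A i j \<noteq> -\<infinity>},
       tail = fst,
       head = snd\<rparr>,
      \<lambda>(j, i). A i j)"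

text \<open>
  Arc weights are never \<open>-\<infinity>\<close>, so the sum of weights along a walk involves no conflicting
  infinities.
\<close>

definition path_weight :: "weighted_graph \<Rightarrow> (nat \<times> nat) awalk \<Rightarrow> ereal" where
  "path_weight G p = sum_list (map (snd G) p)"

definition no_pos_circuit_graphs :: "weighted_graph set"  ("\<Gamma>") where
  "\<Gamma> = {G. (\<exists>n A. G = precedence_graph n A) \<and>
            \<not> (\<exists>p. wf_digraph.closed_w (fst G) p \<and> path_weight G p > 0)}"


text \<open>
  In the following, \<open>A0\<close>, \<open>A1\<close>, \<open>B0\<close>, \<open>B1\<close> assign to each mode its four matrices, and
  \<open>v\<close> is the sequence of modes, with indices starting from 1.
\<close>

definition C_mat :: "('m \<Rightarrow> ematrix) \<Rightarrow> ('m \<Rightarrow> ematrix) \<Rightarrow> (nat \<Rightarrow> 'm) \<Rightarrow> nat \<Rightarrow> ematrix" where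
  "C_mat A0 B0 v k = A0 (v k) \<oplus>\<^sub>m mat_sharp (B0 (v k))"

definition I_mat :: "('m \<Rightarrow> ematrix) \<Rightarrow> (nat \<Rightarrow> 'm) \<Rightarrow> nat \<Rightarrow> ematrix" where
  "I_mat A1 v k = A1 (v k)"

definition P_mat :: "('m \<Rightarrow> ematrix) \<Rightarrow> (nat \<Rightarrow> 'm) \<Rightarrow> nat \<Rightarrow> ematrix" where
  "P_mat B1 v k = mat_sharp (B1 (v k))"

definition PP_mat :: "nat \<Rightarrow> ('m \<Rightarrow> ematrix) \<Rightarrow> ('m \<Rightarrow> ematrix) \<Rightarrow> ('m \<Rightarrow> ematrix)
    \<Rightarrow> (nat \<Rightarrow> 'm) \<Rightarrow> nat \<Rightarrow> ematrix" where
  "PP_mat n A0 B0 B1 v k =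
     mat_star n (C_mat A0 B0 v k) \<otimes>[n] P_mat B1 v k \<otimes>[n] mat_star n (C_mat A0 B0 v (k + 1))"

definition II_mat :: "nat \<Rightarrow> ('m \<Rightarrow> ematrix) \<Rightarrow> ('m \<Rightarrow> ematrix) \<Rightarrow> ('m \<Rightarrow> ematrix)
    \<Rightarrow> (nat \<Rightarrow> 'm) \<Rightarrow> nat \<Rightarrow> ematrix" where
  "II_mat n A0 A1 B0 v k =
     mat_star n (C_mat A0 B0 v (k + 1)) \<otimes>[n] I_mat A1 v k \<otimes>[n] mat_star n (C_mat A0 B0 v k)"

text \<open>
  Backward recursion from \<open>k = K - 1\<close>; only the values for \<open>1 \<le> k \<le> K - 1\<close> are meaningful.
\<close>

function CC_mat :: "nat \<Rightarrow> nat \<Rightarrow> ('m \<Rightarrow> ematrix) \<Rightarrow> ('m \<Rightarrow> ematrix) \<Rightarrow> ('m \<Rightarrow> ematrix)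
    \<Rightarrow> ('m \<Rightarrow> ematrix) \<Rightarrow> (nat \<Rightarrow> 'm) \<Rightarrow> nat \<Rightarrow> ematrix" where
  "CC_mat n K A0 A1 B0 B1 v k =
     (if k \<ge> K - 1
      then PP_mat n A0 B0 B1 v k \<otimes>[n] II_mat n A0 A1 B0 v k
      else PP_mat n A0 B0 B1 v k \<otimes>[n] mat_star n (CC_mat n K A0 A1 B0 B1 v (k + 1))
             \<otimes>[n] II_mat n A0 A1 B0 v k)"
  by pat_completeness auto
termination
  by (relation "measure (\<lambda>(n, K, A0, A1, B0, B1, v, k). K - k)") auto

declare CC_mat.simps [simp del]

primrec MM_prefix :: "nat \<Rightarrow> nat \<Rightarrow> ('m \<Rightarrow> ematrix) \<Rightarrow> ('m \<Rightarrow> ematrix) \<Rightarrow> ('m \<Rightarrow> ematrix)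
    \<Rightarrow> ('m \<Rightarrow> ematrix) \<Rightarrow> (nat \<Rightarrow> 'm) \<Rightarrow> nat \<Rightarrow> ematrix" where
  "MM_prefix n K A0 A1 B0 B1 v 0 = mat_E"
| "MM_prefix n K A0 A1 B0 B1 v (Suc k) =
     II_mat n A0 A1 B0 v (Suc k) \<otimes>[n] mat_star n (CC_mat n K A0 A1 B0 B1 v (Suc k))
       \<otimes>[n] MM_prefix n K A0 A1 B0 B1 v k"

definition MM_mat :: "nat \<Rightarrow> nat \<Rightarrow> ('m \<Rightarrow> ematrix) \<Rightarrow> ('m \<Rightarrow> ematrix) \<Rightarrow> ('m \<Rightarrow> ematrix)
    \<Rightarrow> ('m \<Rightarrow> ematrix) \<Rightarrow> (nat \<Rightarrow> 'm) \<Rightarrow> ematrix" where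
  "MM_mat n K A0 A1 B0 B1 v = MM_prefix n K A0 A1 B0 B1 v (K - 1)"


text \<open>
  \<open>x k i\<close> is the \<open>i\<close>-th component of the vector \<open>x(k)\<close>; its entries are real by typing.
\<close>

definition feasible :: "nat \<Rightarrow> nat \<Rightarrow> ('m \<Rightarrow> ematrix) \<Rightarrow> ('m \<Rightarrow> ematrix) \<Rightarrow> ('m \<Rightarrow> ematrix)
    \<Rightarrow> ('m \<Rightarrow> ematrix) \<Rightarrow> (nat \<Rightarrow> 'm) \<Rightarrow> (nat \<Rightarrow> nat \<Rightarrow> real) \<Rightarrow> bool" where
  "feasible n K A0 A1 B0 B1 v x \<longleftrightarrow>
     (\<forall>k\<in>{1..K}.
        vec_le n (mat_vec_otimes n (A0 (v k)) (\<lambda>i. ereal (x k i))) (\<lambda>i. ereal (x k i)) \<and>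
        vec_le n (\<lambda>i. ereal (x k i)) (mat_vec_boxtimes n (B0 (v k)) (\<lambda>i. ereal (x k i)))) \<and>
     (\<forall>k\<in>{1..K - 1}.
        vec_le n (mat_vec_otimes n (A1 (v k)) (\<lambda>i. ereal (x k i))) (\<lambda>i. ereal (x (k + 1) i)) \<and>
        vec_le n (\<lambda>i. ereal (x (k + 1) i)) (mat_vec_boxtimes n (B1 (v k)) (\<lambda>i. ereal (x k i))))"

definition duration :: "nat \<Rightarrow> nat \<Rightarrow> (nat \<Rightarrow> nat \<Rightarrow> real) \<Rightarrow> real" where
  "duration n K x = x K n - x 1 1"

definition makespan_solution :: "nat \<Rightarrow> nat \<Rightarrow> ('m \<Rightarrow> ematrix) \<Rightarrow> ('m \<Rightarrow> ematrix) \<Rightarrow> ('m \<Rightarrow> ematrix)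
    \<Rightarrow> ('m \<Rightarrow> ematrix) \<Rightarrow> (nat \<Rightarrow> 'm) \<Rightarrow> (nat \<Rightarrow> nat \<Rightarrow> real) \<Rightarrow> bool" where
  "makespan_solution n K A0 A1 B0 B1 v x \<longleftrightarrow>
     feasible n K A0 A1 B0 B1 v x \<and>
     (\<forall>y. feasible n K A0 A1 B0 B1 v y \<longrightarrow> duration n K x \<le> duration n K y)"

definition makespan :: "nat \<Rightarrow> nat \<Rightarrow> ('m \<Rightarrow> ematrix) \<Rightarrow> ('m \<Rightarrow> ematrix) \<Rightarrow> ('m \<Rightarrow> ematrix)
    \<Rightarrow> ('m \<Rightarrow> ematrix) \<Rightarrow> (nat \<Rightarrow> 'm) \<Rightarrow> ereal" where
  "makespan n K A0 A1 B0 B1 v =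
     (INF x\<in>{x. feasible n K A0 A1 B0 B1 v x}. ereal (duration n K x))"

definition permutation_flow_shop :: "nat \<Rightarrow> nat \<Rightarrow> ('m \<Rightarrow> ematrix) \<Rightarrow> ('m \<Rightarrow> ematrix)
    \<Rightarrow> (nat \<Rightarrow> 'm) \<Rightarrow> bool" where
  "permutation_flow_shop n K A0 A1 v \<longleftrightarrow>
     (\<forall>k\<in>{1..K}. \<forall>i\<in>{1..n - 1}. A0 (v k) (i + 1) i \<ge> 0) \<and>
     (\<forall>k\<in>{1..K - 1}. \<forall>i\<in>{1..n}. A1 (v k) i i \<ge> 0)"

end

theory Submission
  imports Defs
begin

text \<open>
  By residuation every constraint can be moved to one side: \<open>x \<le> B \<boxtimes> y\<close> says the same as
  \<open>B\<^sup>\<sharp> \<otimes> x \<le> y\<close>. Feasibility therefore means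
  \<open>C\<^sub>k \<otimes> x(k) \<le> x(k)\<close>, \<open>I\<^sub>k \<otimes> x(k) \<le> x(k+1)\<close> and \<open>P\<^sub>k \<otimes> x(k+1) \<le> x(k)\<close>,
  a system of lower bounds whose solutions are closed under adding a constant.

  Finiteness aside, the proof uses the Kleene star through a single property: \<open>A\<^sup>* \<otimes> x\<close> is the least vector
  \<open>y \<ge> x\<close> with \<open>A \<otimes> y \<le> y\<close> (\<open>star_extensive\<close>, \<open>star_closed\<close>, \<open>star_least\<close>). It
  holds over all of the extended reals, since the max-plus product is associative and
  distributes over suprema, also where infinities of opposite signs meet.

  Eliminating the products \<open>K, K - 1, \<dots>, k + 1\<close> in turn shows that a solution satisfies
  \<open>\<complex>\<^sub>k \<otimes> x(k) \<le> x(k)\<close> (\<open>act_CC_le\<close>): the matrix \<open>\<complex>\<^sub>k\<close> collects what the later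
  products demand of product \<open>k\<close>. A real vector \<open>y\<close> with \<open>A \<otimes> y \<le> y\<close> is a potential for
  the precedence graph of \<open>A\<close> and excludes circuits of positive weight
  (\<open>no_pos_circuitI\<close>), which makes the circuit conditions necessary.

  Conversely, let the first machine start product 1 at time 0 and propagate forwards: pass
  to product \<open>k\<close> whatever product \<open>k - 1\<close> forces on it, close the result under
  \<open>\<complex>\<^sub>k\<close> to anticipate the later products, then close it under \<open>C\<^sub>k\<close>. The resulting schedule
  \<open>earliest\<close> satisfies all lower bounds (\<open>subinvariant_earliest\<close>): the demand of product
  \<open>k + 1\<close> on product \<open>k\<close> is exactly \<open>\<complex>\<^sub>k\<close> applied to a vector that is already closed under
  \<open>\<complex>\<^sub>k\<close>. It also lies below every solution with \<open>x\<^sub>1(1) \<ge> 0\<close> (\<open>earliest_least\<close>). Its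
  entries are real: without positive circuits, deleting circuits from a walk does not lower
  its weight, so that stars of matrices without the entry \<open>\<infinity>\<close> have no entry \<open>\<infinity>\<close> either
  (\<open>star_finite\<close>); and the flow shop hypothesis makes every time a consequence of
  \<open>x\<^sub>1(1) \<ge> 0\<close>, so all entries are nonnegative (\<open>earliest_nonneg\<close>). Hence \<open>earliest\<close> is
  optimal, and for \<open>K \<ge> 2\<close> its last vector is the first column of \<open>\<M>\<close>, factor by factor
  (\<open>earliest_K\<close>).
\<close>

abbreviation mv :: "nat \<Rightarrow> ematrix \<Rightarrow> evector \<Rightarrow> evector" where
  "mv \<equiv> mat_vec_otimes"

section \<open>The max-plus semiring\<close>

lemma otimes_assoc: "(a \<otimes>\<^sub>s b) \<otimes>\<^sub>s c = a \<otimes>\<^sub>s (b \<otimes>\<^sub>s c)"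
  by (cases a; cases b; cases c) (auto simp: otimes_def)

lemma otimes_mono: "a \<le> a' \<Longrightarrow> b \<le> b' \<Longrightarrow> a \<otimes>\<^sub>s b \<le> a' \<otimes>\<^sub>s b'"
  by (auto simp: otimes_def intro: add_mono)

lemma otimes_commute: "a \<otimes>\<^sub>s b = b \<otimes>\<^sub>s a"
  by (auto simp: otimes_def add.commute)

lemma otimes_zero [simp]: "0 \<otimes>\<^sub>s a = a"
  by (auto simp: otimes_def)

lemma otimes_MInf [simp]: "-\<infinity> \<otimes>\<^sub>s a = -\<infinity>" "a \<otimes>\<^sub>s -\<infinity> = -\<infinity>"
  by (auto simp: otimes_def)

lemma otimes_finite: "a \<noteq> \<infinity> \<Longrightarrow> b \<noteq> \<infinity> \<Longrightarrow> a \<otimes>\<^sub>s b \<noteq> \<infinity>"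
  by (auto simp: otimes_def)

lemma otimes_real: "a \<otimes>\<^sub>s ereal r = a + ereal r"
  by (cases a) (auto simp: otimes_def)

text \<open>
  Multiplication by a fixed scalar preserves suprema. For the scalar \<open>\<infinity>\<close> this depends on
  \<open>-\<infinity>\<close> being absorbing, so that the product is \<open>-\<infinity>\<close> when all members are and \<open>\<infinity>\<close>
  otherwise.
\<close>

lemma otimes_SUP_le:
  assumes le: "\<And>r. a \<otimes>\<^sub>s f r \<le> z"
  shows "a \<otimes>\<^sub>s (SUP r. f r) \<le> z"
proof (cases a)
  case (real b)
  have "a + (SUP r. f r) = (SUP r. a + f r)"
    using real by (subst SUP_ereal_add_right) auto
  also have "\<dots> \<le> z"
    using le by (intro SUP_least) (simp add: real otimes_commute[of "ereal b"] otimes_real add.commute)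
  finally show ?thesis
    by (simp add: real otimes_commute[of "ereal b"] otimes_real add.commute)
next
  case PInf
  show ?thesis
  proof (cases "\<forall>r. f r = -\<infinity>")
    case True
    then have "(SUP r. f r) = -\<infinity>" by simp
    then show ?thesis by simp
  next
    case False
    then obtain r where "f r \<noteq> -\<infinity>" by blast
    with le[of r] show ?thesis by (simp add: PInf otimes_def)
  qed
qed simp

lemma otimes_Max_le_iff:
  assumes "finite S" "S \<noteq> {}"
  shows "a \<otimes>\<^sub>s (MAX s\<in>S. f s) \<le> z \<longleftrightarrow> (\<forall>s\<in>S. a \<otimes>\<^sub>s f s \<le> z)"
proof
  assume *: "a \<otimes>\<^sub>s (MAX s\<in>S. f s) \<le> z"
  show "\<forall>s\<in>S. a \<otimes>\<^sub>s f s \<le> z"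
  proof
    fix s assume "s \<in> S"
    then have "f s \<le> (MAX s\<in>S. f s)" using assms by auto
    from otimes_mono[OF order_refl this] * show "a \<otimes>\<^sub>s f s \<le> z" by (rule order_trans)
  qed
next
  assume *: "\<forall>s\<in>S. a \<otimes>\<^sub>s f s \<le> z"
  have "(MAX s\<in>S. f s) \<in> f ` S" using assms by (intro Max_in) auto
  then show "a \<otimes>\<^sub>s (MAX s\<in>S. f s) \<le> z" using * by (metis (no_types, lifting) image_iff)
qed

section \<open>Matrices acting on vectors\<close>

lemma vec_le_refl [simp]: "vec_le n x x"
  by (simp add: vec_le_def)

lemma vec_le_trans [trans]: "vec_le n x y \<Longrightarrow> vec_le n y z \<Longrightarrow> vec_le n x z"
  by (auto simp: vec_le_def intro: order_trans)

lemma column_mat_otimes: "(\<lambda>i. (A \<otimes>[n] B) i h) = mv n A (\<lambda>k. B k h)"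
  by (simp add: mat_otimes_def mat_vec_otimes_def)

lemma mv_cong: "(\<And>i. i \<in> {1..n} \<Longrightarrow> x i = y i) \<Longrightarrow> mv n A x = mv n A y"
  by (simp add: mat_vec_otimes_def fun_eq_iff)

context
  fixes n :: nat
  assumes n_pos: "n \<ge> 1"
begin

lemma mv_le_iff: "mv n A x i \<le> z \<longleftrightarrow> (\<forall>j\<in>{1..n}. A i j \<otimes>\<^sub>s x j \<le> z)"
  using n_pos by (auto simp: mat_vec_otimes_def)

lemma mv_ge: "j \<in> {1..n} \<Longrightarrow> A i j \<otimes>\<^sub>s x j \<le> mv n A x i"
  using mv_le_iff by blast

lemma mv_attained: "\<exists>j\<in>{1..n}. mv n A x i = A i j \<otimes>\<^sub>s x j"
proof -
  have "mv n A x i \<in> (\<lambda>j. A i j \<otimes>\<^sub>s x j) ` {1..n}"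
    using n_pos unfolding mat_vec_otimes_def by (intro Max_in) auto
  then show ?thesis by blast
qed

lemma mv_mono: "vec_le n x y \<Longrightarrow> vec_le n (mv n A x) (mv n A y)"
  unfolding vec_le_def mv_le_iff
  by (meson mv_ge order_refl order_trans otimes_mono)

text \<open>
  Associativity, obtained by comparing upper bounds: either side is at most \<open>z\<close> if and only
  if every triple product is.
\<close>

lemma mv_mat_otimes [simp]: "mv n (A \<otimes>[n] B) x = mv n A (mv n B x)"
proof
  fix i
  have "mv n (A \<otimes>[n] B) x i \<le> z \<longleftrightarrow> mv n A (mv n B x) i \<le> z" for z
  proof -
    have "mv n (A \<otimes>[n] B) x i \<le> z \<longleftrightarrow>
        (\<forall>j\<in>{1..n}. x j \<otimes>\<^sub>s (MAX k\<in>{1..n}. A i k \<otimes>\<^sub>s B k j) \<le> z)"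
      by (simp add: mv_le_iff mat_otimes_def otimes_commute)
    also have "\<dots> \<longleftrightarrow> (\<forall>j\<in>{1..n}. \<forall>k\<in>{1..n}. x j \<otimes>\<^sub>s (A i k \<otimes>\<^sub>s B k j) \<le> z)"
      using n_pos by (subst otimes_Max_le_iff) auto
    also have "\<dots> \<longleftrightarrow> (\<forall>k\<in>{1..n}. \<forall>j\<in>{1..n}. A i k \<otimes>\<^sub>s (B k j \<otimes>\<^sub>s x j) \<le> z)"
      by (auto simp: otimes_commute[of "x _"] otimes_assoc)
    also have "\<dots> \<longleftrightarrow> (\<forall>k\<in>{1..n}. A i k \<otimes>\<^sub>s (MAX j\<in>{1..n}. B k j \<otimes>\<^sub>s x j) \<le> z)"
      using n_pos by (subst otimes_Max_le_iff) auto
    also have "\<dots> \<longleftrightarrow> mv n A (mv n B x) i \<le> z"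
      by (simp only: mv_le_iff mat_vec_otimes_def[of n B x, symmetric] mat_vec_otimes_def[of n B, THEN fun_cong, symmetric])
    finally show ?thesis .
  qed
  then show "mv n (A \<otimes>[n] B) x i = mv n A (mv n B x) i"
    by (metis order_antisym order_refl)
qed

lemma mv_finite:
  assumes "\<And>i j. i \<in> {1..n} \<Longrightarrow> j \<in> {1..n} \<Longrightarrow> A i j \<noteq> \<infinity>"
    and "\<And>j. j \<in> {1..n} \<Longrightarrow> x j \<noteq> \<infinity>" and "i \<in> {1..n}"
  shows "mv n A x i \<noteq> \<infinity>"
  using mv_attained[of A x i] assms otimes_finite by metis

lemma mat_otimes_finite:
  assumes "\<And>i j. i \<in> {1..n} \<Longrightarrow> j \<in> {1..n} \<Longrightarrow> A i j \<noteq> \<infinity>"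
    and "\<And>i j. i \<in> {1..n} \<Longrightarrow> j \<in> {1..n} \<Longrightarrow> B i j \<noteq> \<infinity>"
    and "i \<in> {1..n}" "j \<in> {1..n}"
  shows "(A \<otimes>[n] B) i j \<noteq> \<infinity>"
  using mv_finite[of A "\<lambda>k. B k j" i] assms fun_cong[OF column_mat_otimes[of A n B j], of i] by simp

section \<open>The Kleene star as a closure operator\<close>

lemma mv_mat_E: "i \<in> {1..n} \<Longrightarrow> mv n mat_E x i = x i"
proof (rule order_antisym)
  assume i: "i \<in> {1..n}"
  show "mv n mat_E x i \<le> x i" by (auto simp: mv_le_iff mat_E_def)
  show "x i \<le> mv n mat_E x i" using mv_ge[OF i, of mat_E i x] by (simp add: mat_E_def)
qed

text \<open>
  Powers are built by multiplication from the right, whereas closedness of the star under \<open>A\<close>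
  is about multiplication from the left.
\<close>

lemma mv_power_Suc_left:
  "i \<in> {1..n} \<Longrightarrow> mv n (mat_power n A (Suc r)) x i = mv n A (mv n (mat_power n A r) x) i"
proof (induction r arbitrary: x)
  case 0
  then show ?case using mv_cong[of n "mv n mat_E x" x A] mv_mat_E by simp
next
  case (Suc r)
  have "mv n (mat_power n A (Suc (Suc r))) x i = mv n (mat_power n A (Suc r)) (mv n A x) i"
    by simp
  also have "\<dots> = mv n A (mv n (mat_power n A r) (mv n A x)) i"
    using Suc.IH[of "mv n A x"] Suc.prems by simp
  also have "\<dots> = mv n A (mv n (mat_power n A (Suc r)) x) i"
    by simp
  finally show ?case .
qed

lemma mv_star_le_iff: "mv n (mat_star n A) x i \<le> z \<longleftrightarrow> (\<forall>r. mv n (mat_power n A r) x i \<le> z)"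
proof
  assume *: "mv n (mat_star n A) x i \<le> z"
  have "mat_power n A r i j \<le> mat_star n A i j" for r j
    unfolding mat_star_def by (rule SUP_upper) simp
  then show "\<forall>r. mv n (mat_power n A r) x i \<le> z"
    using * unfolding mv_le_iff by (meson order_refl order_trans otimes_mono)
next
  assume "\<forall>r. mv n (mat_power n A r) x i \<le> z"
  then have "x j \<otimes>\<^sub>s mat_power n A r i j \<le> z" if "j \<in> {1..n}" for r j
    using that by (simp add: mv_le_iff otimes_commute)
  then have "x j \<otimes>\<^sub>s mat_star n A i j \<le> z" if "j \<in> {1..n}" for j
    unfolding mat_star_def using that by (intro otimes_SUP_le)
  then show "mv n (mat_star n A) x i \<le> z"
    by (simp add: mv_le_iff otimes_commute)
qed

lemma star_extensive: "vec_le n x (mv n (mat_star n A) x)"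
  unfolding vec_le_def
proof
  fix i assume i: "i \<in> {1..n}"
  have "mv n (mat_power n A 0) x i \<le> mv n (mat_star n A) x i"
    using mv_star_le_iff by blast
  then show "x i \<le> mv n (mat_star n A) x i" using mv_mat_E[OF i] by simp
qed

lemma star_closed: "vec_le n (mv n A (mv n (mat_star n A) x)) (mv n (mat_star n A) x)"
  unfolding vec_le_def
proof
  let ?S = "mv n (mat_star n A) x"
  fix i assume i: "i \<in> {1..n}"
  have "mv n (A \<otimes>[n] mat_star n A) x i \<le> ?S i"
    unfolding mv_le_iff
  proof
    fix j assume j: "j \<in> {1..n}"
    have "x j \<otimes>\<^sub>s (A i k \<otimes>\<^sub>s mat_star n A k j) \<le> ?S i" if k: "k \<in> {1..n}" for k
    proof -
      have "(x j \<otimes>\<^sub>s A i k) \<otimes>\<^sub>s mat_power n A r k j \<le> ?S i" for r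
      proof -
        have "(x j \<otimes>\<^sub>s A i k) \<otimes>\<^sub>s mat_power n A r k j
            = A i k \<otimes>\<^sub>s (mat_power n A r k j \<otimes>\<^sub>s x j)"
          by (metis otimes_assoc otimes_commute)
        also have "\<dots> \<le> A i k \<otimes>\<^sub>s mv n (mat_power n A r) x k"
          by (intro otimes_mono order_refl mv_ge j)
        also have "\<dots> \<le> mv n A (mv n (mat_power n A r) x) i"
          by (rule mv_ge[OF k])
        also have "\<dots> = mv n (mat_power n A (Suc r)) x i"
          by (rule mv_power_Suc_left[OF i, symmetric])
        also have "\<dots> \<le> ?S i"
          using mv_star_le_iff by blast
        finally show ?thesis .
      qed
      then show ?thesis
        unfolding mat_star_def otimes_assoc[symmetric] by (rule otimes_SUP_le)
    qed
    then show "(A \<otimes>[n] mat_star n A) i j \<otimes>\<^sub>s x j \<le> ?S i"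
      using n_pos by (simp add: mat_otimes_def otimes_commute[of _ "x j"] otimes_Max_le_iff)
  qed
  then show "mv n A ?S i \<le> ?S i" by simp
qed

text \<open>
  Induction over the powers: each of them maps \<open>x\<close> below \<open>y\<close>.
\<close>

lemma star_least:
  assumes "vec_le n x y" "vec_le n (mv n A y) y"
  shows "vec_le n (mv n (mat_star n A) x) y"
proof -
  have "vec_le n (mv n (mat_power n A r) x) y" for r
  proof (induction r)
    case 0
    then show ?case using assms(1) by (simp add: vec_le_def mv_mat_E)
  next
    case (Suc r)
    have "vec_le n (mv n A (mv n (mat_power n A r) x)) y"
      using mv_mono[OF Suc, of A] assms(2) by (rule vec_le_trans)
    then show ?case unfolding vec_le_def using mv_power_Suc_left by metis
  qed
  then show ?thesis by (simp add: vec_le_def mv_star_le_iff)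
qed

lemma star_idem:
  "vec_le n (mv n (mat_star n A) (mv n (mat_star n A) x)) (mv n (mat_star n A) x)"
  by (intro star_least star_closed vec_le_refl)

section \<open>Circuits\<close>

lemma fin_digraph_precedence: "fin_digraph (fst (precedence_graph n A))"
proof unfold_locales
  show "finite (arcs (fst (precedence_graph n A)))"
    by (rule finite_subset[of _ "{1..n} \<times> {1..n}"]) (auto simp: precedence_graph_def)
qed (auto simp: precedence_graph_def)

lemma wf_digraph_precedence: "wf_digraph (fst (precedence_graph n A))"
  using fin_digraph_precedence by (simp add: fin_digraph_def)

lemma precedence_graph_simps [simp]:
  "verts (fst (precedence_graph n A)) = {1..n}"
  "(j, i) \<in> arcs (fst (precedence_graph n A)) \<longleftrightarrow> j \<in> {1..n} \<and> i \<in> {1..n} \<and> A i j \<noteq> -\<infinity>"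
  "tail (fst (precedence_graph n A)) = fst"
  "head (fst (precedence_graph n A)) = snd"
  "snd (precedence_graph n A) (j, i) = A i j"
  by (simp_all add: precedence_graph_def)

lemma path_weight_simps [simp]:
  "path_weight G [] = 0"
  "path_weight G (e # p) = snd G e + path_weight G p"
  "path_weight G (p @ q) = path_weight G p + path_weight G q"
  by (simp_all add: path_weight_def)

text \<open>
  A real vector that \<open>A\<close> does not raise is a potential: along an arc it increases by at least
  the weight of the arc, and these increases telescope along a walk.
\<close>

lemma path_weight_le_potential:
  assumes sub: "vec_le n (mv n A (\<lambda>i. ereal (y i))) (\<lambda>i. ereal (y i))"
    and "pre_digraph.awalk (fst (precedence_graph n A)) u p w"
  shows "path_weight (precedence_graph n A) p + ereal (y u) \<le> ereal (y w)"
proof -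
  interpret wf_digraph "fst (precedence_graph n A)" by (rule wf_digraph_precedence)
  show ?thesis using assms(2)
  proof (induction p arbitrary: u)
    case Nil
    then show ?case by (simp add: awalk_Nil_iff)
  next
    case (Cons e p)
    obtain j i where e: "e = (j, i)" by (cases e)
    have *: "j \<in> {1..n}" "i \<in> {1..n}" "u = j" and walk: "awalk i p w"
      using Cons.prems by (simp_all add: awalk_Cons_iff e)
    have "A i j + ereal (y j) \<le> ereal (y i)"
      using sub * by (auto simp: vec_le_def mv_le_iff otimes_real)
    then have "path_weight (precedence_graph n A) p + (A i j + ereal (y j))
        \<le> path_weight (precedence_graph n A) p + ereal (y i)"
      by (rule add_left_mono)
    also have "\<dots> \<le> ereal (y w)" by (rule Cons.IH[OF walk])
    finally show ?case using * by (simp add: e ac_simps)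
  qed
qed

lemma no_pos_circuitI:
  assumes "vec_le n (mv n A (\<lambda>i. ereal (y i))) (\<lambda>i. ereal (y i))"
  shows "precedence_graph n A \<in> \<Gamma>"
proof -
  interpret wf_digraph "fst (precedence_graph n A)" by (rule wf_digraph_precedence)
  have "\<not> 0 < path_weight (precedence_graph n A) p" if "closed_w p" for p
  proof -
    obtain u where "awalk u p u" using \<open>closed_w p\<close> by (auto simp: closed_w_def)
    from path_weight_le_potential[OF assms this] show ?thesis
      by (cases "path_weight (precedence_graph n A) p") auto
  qed
  then show ?thesis by (auto simp: no_pos_circuit_graphs_def)
qed

text \<open>
  The maxima in the definition of a power are attained, so following the maximisers backwards
  yields a walk.
\<close>

lemma mat_power_is_path_weight:
  assumes "mat_power n A r i j \<noteq> -\<infinity>" "i \<in> {1..n}" "j \<in> {1..n}"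
    and fin: "\<And>i j. i \<in> {1..n} \<Longrightarrow> j \<in> {1..n} \<Longrightarrow> A i j \<noteq> \<infinity>"
  shows "\<exists>p. pre_digraph.awalk (fst (precedence_graph n A)) j p i
           \<and> path_weight (precedence_graph n A) p = mat_power n A r i j"
proof -
  interpret wf_digraph "fst (precedence_graph n A)" by (rule wf_digraph_precedence)
  show ?thesis using assms(1-3)
  proof (induction r arbitrary: j)
    case 0
    then have "i = j" by (auto simp: mat_E_def split: if_splits)
    then show ?case using 0
      by (intro exI[of _ "[]"]) (simp add: awalk_Nil_iff mat_E_def)
  next
    case (Suc r)
    obtain k where k: "k \<in> {1..n}" and
      eq: "mat_power n A (Suc r) i j = mat_power n A r i k \<otimes>\<^sub>s A k j"
      using mv_attained[of "mat_power n A r" "\<lambda>k. A k j" i]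
      by (auto simp: mat_otimes_def mat_vec_otimes_def)
    have ne: "mat_power n A r i k \<noteq> -\<infinity>" "A k j \<noteq> -\<infinity>"
      using Suc.prems(1) unfolding eq by auto
    from Suc.IH[OF ne(1) \<open>i \<in> {1..n}\<close> k] obtain p where
      "awalk k p i" "path_weight (precedence_graph n A) p = mat_power n A r i k" by blast
    then have "awalk j ((j, k) # p) i \<and>
        path_weight (precedence_graph n A) ((j, k) # p) = mat_power n A (Suc r) i j"
      using k Suc.prems ne unfolding eq
      by (simp add: awalk_Cons_iff otimes_def add.commute)
    then show ?case by blast
  qed
qed

text \<open>
  Cutting a circuit out of a walk does not lower the weight if no circuit has positive weight.
  So every walk weighs at most as much as some walk without repeated nodes, and there are
  only finitely many of these.
\<close>

lemma star_finite:
  assumes fin: "\<And>i j. i \<in> {1..n} \<Longrightarrow> j \<in> {1..n} \<Longrightarrow> A i j \<noteq> \<infinity>"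
    and gamma: "precedence_graph n A \<in> \<Gamma>"
    and i: "i \<in> {1..n}" and j: "j \<in> {1..n}"
  shows "mat_star n A i j \<noteq> \<infinity>"
proof -
  let ?G = "precedence_graph n A"
  let ?P = "{p. pre_digraph.apath (fst ?G) j p i}"
  interpret fin_digraph "fst ?G" by (rule fin_digraph_precedence)
  \<comment> \<open>The extra element \<open>-\<infinity>\<close> covers the case that no walk from \<open>j\<close> to \<open>i\<close> exists.\<close>
  define M where "M = Max (insert (-\<infinity>) (path_weight ?G ` ?P))"
  have finP: "finite ?P" by (rule apaths_finite)
  have weight_finite: "path_weight ?G p \<noteq> \<infinity>" if "awalk u p w" for u p w
    using that
  proof (induction p arbitrary: u)
    case (Cons e p)
    then have "snd ?G e \<noteq> \<infinity>" using fin
      by (cases e) (simp add: awalk_Cons_iff)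
    with Cons show ?case by (auto simp: awalk_Cons_iff)
  qed simp
  have "M \<noteq> \<infinity>"
  proof -
    have "M \<in> insert (-\<infinity>) (path_weight ?G ` ?P)"
      unfolding M_def using finP by (intro Max_in) auto
    then show ?thesis
    proof
      assume "M \<in> path_weight ?G ` ?P"
      then obtain p where "awalk j p i" "M = path_weight ?G p" by (auto simp: apath_def)
      then show ?thesis using weight_finite by simp
    qed simp
  qed
  have le_M: "path_weight ?G p \<le> M" if "awalk j p i" for p
    using that
  proof (induction rule: awalk_to_apath_induct)
    case (path p)
    then show ?case unfolding M_def using finP by (intro Max_ge) (auto simp: apath_def)
  next
    case (decomp p q r s)
    have p: "p = q @ r @ s" and r: "closed_w r"
      using decomp by (auto elim: awalk_cyc_decompE)
    have "path_weight ?G r \<le> 0"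
      using gamma r by (auto simp: no_pos_circuit_graphs_def not_less)
    then have "path_weight ?G q + (path_weight ?G r + path_weight ?G s)
        \<le> path_weight ?G q + (0 + path_weight ?G s)"
      by (intro add_left_mono add_right_mono)
    with decomp show ?case by (simp add: p)
  qed
  have "mat_power n A r i j \<le> M" for r
  proof (cases "mat_power n A r i j = -\<infinity>")
    case False
    from mat_power_is_path_weight[OF this i j fin] obtain p
      where "awalk j p i" "path_weight ?G p = mat_power n A r i j" by blast
    with le_M show ?thesis by metis
  qed simp
  then have "mat_star n A i j \<le> M"
    unfolding mat_star_def by (intro SUP_least)
  with \<open>M \<noteq> \<infinity>\<close> show ?thesis by auto
qed

end

section \<open>Constraints as one-sided max-plus inequalities\<close>

text \<open>
  The two products treat infinities of opposite signs differently for the sake of this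
  residuation, by which the upper bounds given by the matrices \<open>B\<close> become lower bounds.
\<close>

lemma boxtimes_residual: "a \<le> b \<boxtimes>\<^sub>s c \<longleftrightarrow> - b \<otimes>\<^sub>s a \<le> c"
  by (cases a; cases b; cases c) (auto simp: boxtimes_def otimes_def)

lemma vec_le_boxtimes_iff:
  assumes "n \<ge> 1"
  shows "vec_le n x (mat_vec_boxtimes n B y) \<longleftrightarrow> vec_le n (mv n (mat_sharp B) x) y"
proof -
  have "x i \<le> mat_vec_boxtimes n B y i \<longleftrightarrow> (\<forall>j\<in>{1..n}. - B i j \<otimes>\<^sub>s x i \<le> y j)" for i
    using assms by (simp add: mat_vec_boxtimes_def boxtimes_residual)
  then show ?thesis
    by (auto simp: vec_le_def mv_le_iff[OF assms] mat_sharp_def)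
qed

lemma vec_le_mv_oplus_iff:
  assumes "n \<ge> 1"
  shows "vec_le n (mv n (A \<oplus>\<^sub>m B) x) y \<longleftrightarrow> vec_le n (mv n A x) y \<and> vec_le n (mv n B x) y"
proof -
  have "max a b \<otimes>\<^sub>s c \<le> z \<longleftrightarrow> a \<otimes>\<^sub>s c \<le> z \<and> b \<otimes>\<^sub>s c \<le> z" for a b c z
    by (metis max.cobounded1 max.cobounded2 max_def order_refl order_trans otimes_mono)
  then show ?thesis by (auto simp: vec_le_def mv_le_iff[OF assms] mat_oplus_def)
qed

lemma vec_le_mv_shift:
  assumes "n \<ge> 1" and "vec_le n (mv n A (\<lambda>i. ereal (x i))) (\<lambda>i. ereal (y i))"
  shows "vec_le n (mv n A (\<lambda>i. ereal (x i - c))) (\<lambda>i. ereal (y i - c))"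
proof -
  have "a \<otimes>\<^sub>s ereal (r - c) \<le> ereal (s - c)" if "a \<otimes>\<^sub>s ereal r \<le> ereal s" for a r s
    using that by (cases a) (auto simp: otimes_real)
  then show ?thesis using assms(2) by (auto simp: vec_le_def mv_le_iff[OF assms(1)])
qed

locale schedule =
  fixes n K :: nat and A0 A1 B0 B1 :: "'m \<Rightarrow> ematrix" and v :: "nat \<Rightarrow> 'm"
  assumes n_pos: "n \<ge> 1" and K_pos: "K \<ge> 1"
begin

abbreviation "C \<equiv> C_mat A0 B0 v"
abbreviation "I \<equiv> I_mat A1 v"
abbreviation "P \<equiv> P_mat B1 v"
abbreviation "PP \<equiv> PP_mat n A0 B0 B1 v"
abbreviation "II \<equiv> II_mat n A0 A1 B0 v"
abbreviation "CC \<equiv> CC_mat n K A0 A1 B0 B1 v"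
abbreviation "star \<equiv> mat_star n"
abbreviation "act \<equiv> mat_vec_otimes n"

text \<open>
  The constraints in one-sided form, for vectors that may have infinite entries, so that the
  schedule constructed below can be discussed before its entries are known to be real.
\<close>

definition subinvariant :: "(nat \<Rightarrow> evector) \<Rightarrow> bool" where
  "subinvariant x \<longleftrightarrow>
     (\<forall>k\<in>{1..K}. vec_le n (act (C k) (x k)) (x k)) \<and>
     (\<forall>k\<in>{1..K - 1}. vec_le n (act (I k) (x k)) (x (k + 1)) \<and>
                      vec_le n (act (P k) (x (k + 1))) (x k))"

lemma feasible_iff_subinvariant:
  "feasible n K A0 A1 B0 B1 v x \<longleftrightarrow> subinvariant (\<lambda>k i. ereal (x k i))"
  by (simp add: feasible_def subinvariant_def vec_le_boxtimes_iff[OF n_pos]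
      vec_le_mv_oplus_iff[OF n_pos] C_mat_def I_mat_def P_mat_def)

lemma feasible_shift:
  "feasible n K A0 A1 B0 B1 v x \<Longrightarrow> feasible n K A0 A1 B0 B1 v (\<lambda>k i. x k i - c)"
  unfolding feasible_iff_subinvariant subinvariant_def
  by (auto intro: vec_le_mv_shift[OF n_pos])

section \<open>Eliminating the later products\<close>

lemma act_PP: "act (PP k) x = act (star (C k)) (act (P k) (act (star (C (k + 1))) x))"
  by (simp add: PP_mat_def mv_mat_otimes[OF n_pos])

lemma act_II: "act (II k) x = act (star (C (k + 1))) (act (I k) (act (star (C k)) x))"
  by (simp add: II_mat_def mv_mat_otimes[OF n_pos])

lemma act_CC:
  assumes "1 \<le> k" "k < K"
  shows "act (CC k) x =
    act (PP k) (if k + 1 < K then act (star (CC (k + 1))) (act (II k) x) else act (II k) x)"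
  using assms by (subst CC_mat.simps) (auto simp: mv_mat_otimes[OF n_pos])

lemma star_least_self: "vec_le n (act A x) x \<Longrightarrow> vec_le n (act (star A) x) x"
  by (rule star_least[OF n_pos]) simp_all

lemma act_le: "vec_le n x y \<Longrightarrow> vec_le n (act A y) z \<Longrightarrow> vec_le n (act A x) z"
  using mv_mono[OF n_pos] vec_le_trans by blast

lemma act_II_le:
  assumes "subinvariant x" "k \<in> {1..K - 1}"
  shows "vec_le n (act (II k) (x k)) (x (k + 1))"
proof -
  have "k \<in> {1..K}" "k + 1 \<in> {1..K}" using assms(2) by auto
  then show ?thesis using assms unfolding act_II subinvariant_def
    by (meson act_le star_least_self)
qed

lemma act_PP_le:
  assumes "subinvariant x" "k \<in> {1..K - 1}"
  shows "vec_le n (act (PP k) (x (k + 1))) (x k)"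
proof -
  have "k \<in> {1..K}" "k + 1 \<in> {1..K}" using assms(2) by auto
  then show ?thesis using assms unfolding act_PP subinvariant_def
    by (meson act_le star_least_self)
qed

text \<open>
  The recursion for \<open>\<complex>\<^sub>k\<close> follows a round trip from product \<open>k\<close> to product \<open>k + 1\<close>, any number
  of round trips beyond it, and back; each leg keeps a solution within its own bounds.
\<close>

lemma act_CC_le:
  assumes sub: "subinvariant x" and "k \<in> {1..K - 1}"
  shows "vec_le n (act (CC k) (x k)) (x k)"
  using assms(2)
proof (induction "K - k" arbitrary: k rule: less_induct)
  case less
  then have k: "1 \<le> k" "k < K" by auto
  note II = act_II_le[OF sub less.prems] and PP = act_PP_le[OF sub less.prems]
  show ?case
  proof (cases "k + 1 < K")
    case True
    then have "vec_le n (act (CC (k + 1)) (x (k + 1))) (x (k + 1))"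
      using less.hyps[of "k + 1"] k by auto
    then have "vec_le n (act (star (CC (k + 1))) (act (II k) (x k))) (x (k + 1))"
      by (intro act_le[OF II] star_least_self)
    then show ?thesis using True act_le[OF _ PP] by (simp add: act_CC[OF k])
  next
    case False
    then show ?thesis using act_le[OF II PP] by (simp add: act_CC[OF k])
  qed
qed

section \<open>The earliest schedule\<close>

text \<open>
  \<open>released k\<close> is what the earlier products impose on product \<open>k\<close>, starting from the first unit
  vector: only machine 1 is bound, to time 0. Closing under \<open>\<complex>\<^sub>k\<close>, which gives \<open>settled k\<close>,
  adds what the later products impose through product \<open>k\<close>.
\<close>

definition released :: "nat \<Rightarrow> evector" where
  "released k = (\<lambda>i. MM_prefix n K A0 A1 B0 B1 v (k - 1) i 1)"

definition settled :: "nat \<Rightarrow> evector" where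
  "settled k = (if k < K then act (star (CC k)) (released k) else released k)"

text \<open>
  The final star is needed because \<open>\<complex>\<^sub>k\<^sup>*\<close> contains the identity next to terms that already
  have the factor \<open>C\<^sub>k\<^sup>*\<close>, so that \<open>settled k\<close> itself may violate the constraints within
  product \<open>k\<close>.
\<close>

definition earliest :: "nat \<Rightarrow> evector" where
  "earliest k = act (star (C k)) (settled k)"

lemma released_1: "released (Suc 0) = (\<lambda>i. mat_E i 1)"
  by (simp add: released_def)

lemma released_Suc:
  assumes "k \<in> {1..K - 1}"
  shows "released (k + 1) = act (II k) (settled k)"
proof -
  obtain m where "k = Suc m" using assms by (cases k) auto
  moreover have "Suc m < K" using assms calculation by auto
  ultimately show ?thesis
    by (simp add: released_def settled_def column_mat_otimes mv_mat_otimes[OF n_pos])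
qed

lemma released_le_settled: "vec_le n (released k) (settled k)"
  using star_extensive[OF n_pos] by (simp add: settled_def)

lemma settled_le_earliest: "vec_le n (settled k) (earliest k)"
  using star_extensive[OF n_pos] by (simp add: earliest_def)

lemma released_le_earliest: "vec_le n (released k) (earliest k)"
  using released_le_settled settled_le_earliest by (rule vec_le_trans)

lemma released_Suc_earliest:
  assumes "k \<in> {1..K - 1}"
  shows "released (k + 1) = act (star (C (k + 1))) (act (I k) (earliest k))"
  by (simp only: released_Suc[OF assms] act_II earliest_def)

lemma subinvariant_earliest: "subinvariant earliest"
  unfolding subinvariant_def
proof (intro conjI ballI)
  fix k assume "k \<in> {1..K}"
  show "vec_le n (act (C k) (earliest k)) (earliest k)"
    unfolding earliest_def by (rule star_closed[OF n_pos])
next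
  fix k assume k: "k \<in> {1..K - 1}"
  have "vec_le n (act (I k) (earliest k)) (released (k + 1))"
    unfolding released_Suc_earliest[OF k] by (rule star_extensive[OF n_pos])
  then show "vec_le n (act (I k) (earliest k)) (earliest (k + 1))"
    using released_le_earliest by (rule vec_le_trans)
  from k have k': "1 \<le> k" "k < K" by auto
  \<comment> \<open>The demand of product \<open>k + 1\<close> on product \<open>k\<close> is \<open>\<complex>\<^sub>k\<close> applied to \<open>settled k\<close>, and
      \<open>settled k\<close> is closed under \<open>\<complex>\<^sub>k\<close>.\<close>
  have "vec_le n (act (P k) (earliest (k + 1)))
      (act (star (C k)) (act (P k) (earliest (k + 1))))"
    by (rule star_extensive[OF n_pos])
  also have "act (star (C k)) (act (P k) (earliest (k + 1))) = act (CC k) (settled k)"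
    by (simp add: act_CC[OF k'] act_PP earliest_def settled_def[of "Suc k"]
        released_Suc[OF k, simplified])
  also have "vec_le n (act (CC k) (settled k)) (settled k)"
    using k' star_closed[OF n_pos] by (simp add: settled_def)
  also note settled_le_earliest
  finally show "vec_le n (act (P k) (earliest (k + 1))) (earliest k)" .
qed

text \<open>
  Each step of the construction of \<open>earliest\<close> is either a closure or the passage from one
  product to the next, and a solution is stable under both; so induction over the products
  keeps the construction below it.
\<close>

lemma earliest_least:
  assumes sub: "subinvariant y" and start: "0 \<le> y 1 1" and "k \<in> {1..K}"
  shows "vec_le n (earliest k) (y k)"
proof -
  have settled: "vec_le n (settled k) (y k)"
    if rel: "vec_le n (released k) (y k)" and k: "k \<in> {1..K}" for k
    using act_le[OF rel star_least_self[OF act_CC_le[OF sub]]] rel k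
    by (auto simp: settled_def)
  have rel: "vec_le n (released k) (y k)" if "1 \<le> k" "k \<le> K" for k
    using that
  proof (induction k rule: dec_induct)
    case base
    then show ?case using start by (simp add: vec_le_def released_1 mat_E_def)
  next
    case (step k)
    then have k: "k \<in> {1..K - 1}" by auto
    then have "vec_le n (settled k) (y k)" using step by (intro settled) auto
    then have "vec_le n (act (II k) (settled k)) (y (k + 1))"
      by (rule act_le[OF _ act_II_le[OF sub k]])
    then show ?case using released_Suc[OF k] by simp
  qed
  have "vec_le n (settled k) (y k)" using assms(3) by (intro settled rel) auto
  then show ?thesis unfolding earliest_def
    using sub assms(3) by (intro star_least[OF n_pos]) (auto simp: subinvariant_def)
qed

text \<open>
  The last product has no successor to anticipate, and its star \<open>C\<^sub>K\<^sup>*\<close> is absorbed by the left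
  factor \<open>C\<^sub>K\<^sup>*\<close> of \<open>II (K - 1)\<close>; for \<open>K = 1\<close> there is no such factor.
\<close>

lemma earliest_K:
  assumes "K \<ge> 2" "i \<in> {1..n}"
  shows "earliest K i = MM_mat n K A0 A1 B0 B1 v i 1"
proof -
  have K: "K - 1 \<in> {1..K - 1}" "K - 1 + 1 = K" using assms(1) by auto
  have rel: "released K = act (star (C K)) (act (I (K - 1)) (earliest (K - 1)))"
    using released_Suc_earliest[OF K(1)] K(2) by simp
  have "vec_le n (earliest K) (released K)"
    unfolding earliest_def settled_def by (simp add: rel star_idem[OF n_pos])
  then have "earliest K i = released K i"
    using released_le_earliest[of K] assms(2) by (auto simp: vec_le_def intro: order_antisym)
  then show ?thesis by (simp add: released_def MM_mat_def)
qed

section \<open>Finiteness of the earliest schedule\<close>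

context
  assumes C_fin: "\<And>k i j. k \<in> {1..K} \<Longrightarrow> i \<in> {1..n} \<Longrightarrow> j \<in> {1..n} \<Longrightarrow> C k i j \<noteq> \<infinity>"
    and I_fin: "\<And>k i j. k \<in> {1..K - 1} \<Longrightarrow> i \<in> {1..n} \<Longrightarrow> j \<in> {1..n} \<Longrightarrow> I k i j \<noteq> \<infinity>"
    and P_fin: "\<And>k i j. k \<in> {1..K - 1} \<Longrightarrow> i \<in> {1..n} \<Longrightarrow> j \<in> {1..n} \<Longrightarrow> P k i j \<noteq> \<infinity>"
    and C_gamma: "\<And>k. k \<in> {1..K} \<Longrightarrow> precedence_graph n (C k) \<in> \<Gamma>"
    and CC_gamma: "\<And>k. k \<in> {1..K - 1} \<Longrightarrow> precedence_graph n (CC k) \<in> \<Gamma>"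
begin

lemma star_C_fin:
  "k \<in> {1..K} \<Longrightarrow> i \<in> {1..n} \<Longrightarrow> j \<in> {1..n} \<Longrightarrow> star (C k) i j \<noteq> \<infinity>"
  by (intro star_finite[OF n_pos] C_fin C_gamma)

lemma II_fin:
  assumes "k \<in> {1..K - 1}" "i \<in> {1..n}" "j \<in> {1..n}"
  shows "II k i j \<noteq> \<infinity>"
  unfolding II_mat_def using assms
  by (intro mat_otimes_finite[OF n_pos] star_C_fin I_fin) auto

lemma PP_fin:
  assumes "k \<in> {1..K - 1}" "i \<in> {1..n}" "j \<in> {1..n}"
  shows "PP k i j \<noteq> \<infinity>"
  unfolding PP_mat_def using assms
  by (intro mat_otimes_finite[OF n_pos] star_C_fin P_fin) auto

text \<open>
  Backward induction, because \<open>\<complex>\<^sub>k\<close> contains the star of \<open>\<complex>\<^bsub>k+1\<^esub>\<close>, whose finiteness depends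
  both on the finiteness of that matrix and on the circuit condition for it.
\<close>

lemma CC_fin:
  assumes "k \<in> {1..K - 1}" "i \<in> {1..n}" "j \<in> {1..n}"
  shows "CC k i j \<noteq> \<infinity>"
  using assms
proof (induction "K - k" arbitrary: k i j rule: less_induct)
  case less
  show ?case
  proof (cases "K - 1 \<le> k")
    case True
    then have "CC k = PP k \<otimes>[n] II k" by (subst CC_mat.simps) simp
    then show ?thesis using less.prems
      by (simp only:) (intro mat_otimes_finite[OF n_pos] PP_fin II_fin)
  next
    case False
    then have CC: "CC k = PP k \<otimes>[n] star (CC (k + 1)) \<otimes>[n] II k"
      by (subst CC_mat.simps) simp
    have k: "k + 1 \<in> {1..K - 1}" using False by auto
    have "star (CC (k + 1)) i j \<noteq> \<infinity>" if "i \<in> {1..n}" "j \<in> {1..n}" for i j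
      using that k False by (intro star_finite[OF n_pos] CC_gamma less.hyps) auto
    then show ?thesis using less.prems unfolding CC
      by (intro mat_otimes_finite[OF n_pos] PP_fin II_fin)
  qed
qed

lemma settled_fin:
  assumes "k \<in> {1..K}" "i \<in> {1..n}" and "\<And>j. j \<in> {1..n} \<Longrightarrow> released k j \<noteq> \<infinity>"
  shows "settled k i \<noteq> \<infinity>"
proof (cases "k < K")
  case True
  then have k: "k \<in> {1..K - 1}" using assms(1) by auto
  have "act (star (CC k)) (released k) i \<noteq> \<infinity>"
    using k assms(2,3) by (intro mv_finite[OF n_pos] star_finite[OF n_pos] CC_fin CC_gamma)
  then show ?thesis using True by (simp add: settled_def)
qed (use assms in \<open>simp add: settled_def\<close>)

lemma released_fin:
  assumes "k \<in> {1..K}" "i \<in> {1..n}"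
  shows "released k i \<noteq> \<infinity>"
proof -
  have "1 \<le> k" "k \<le> K" using assms(1) by auto
  then show ?thesis using assms(2)
  proof (induction k arbitrary: i rule: dec_induct)
    case base
    then show ?case by (simp add: released_1 mat_E_def)
  next
    case (step k)
    then have k: "k \<in> {1..K - 1}" "k \<in> {1..K}" by auto
    have "act (II k) (settled k) i \<noteq> \<infinity>"
      using k step by (intro mv_finite[OF n_pos] II_fin settled_fin) auto
    then show ?case using released_Suc[OF k(1)] by simp
  qed
qed

lemma earliest_fin:
  assumes "k \<in> {1..K}" "i \<in> {1..n}"
  shows "earliest k i \<noteq> \<infinity>"
  unfolding earliest_def using assms
  by (intro mv_finite[OF n_pos] star_C_fin settled_fin released_fin)

lemma subinvariant_act_le:
  assumes "vec_le n (act A x) y" "i \<in> {1..n}" "j \<in> {1..n}" "0 \<le> A i j"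
  shows "x j \<le> y i"
proof -
  have "x j = 0 \<otimes>\<^sub>s x j" by simp
  also have "\<dots> \<le> A i j \<otimes>\<^sub>s x j" using assms(4) by (intro otimes_mono) auto
  also have "\<dots> \<le> y i" using assms(1-3) by (auto simp: vec_le_def mv_le_iff[OF n_pos])
  finally show ?thesis .
qed

text \<open>
  In a flow shop no operation can come before the start of product 1 on machine 1: the
  subdiagonal entries carry the bound 0 from machine to machine, the diagonal ones from product
  to product.
\<close>

lemma earliest_nonneg:
  assumes flow: "permutation_flow_shop n K A0 A1 v" and "k \<in> {1..K}" "i \<in> {1..n}"
  shows "0 \<le> earliest k i"
proof -
  have stage: "0 \<le> earliest k i" if first: "0 \<le> earliest k 1" and k: "k \<in> {1..K}"
    and "1 \<le> i" "i \<le> n" for k i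
    using that(3,4)
  proof (induction i rule: dec_induct)
    case base
    show ?case by (rule first)
  next
    case (step i)
    have "0 \<le> A0 (v k) (i + 1) i"
      using flow k step unfolding permutation_flow_shop_def by auto
    then have "0 \<le> C k (Suc i) i" by (simp add: C_mat_def mat_oplus_def le_max_iff_disj)
    moreover have "vec_le n (act (C k) (earliest k)) (earliest k)"
      using subinvariant_earliest k by (auto simp: subinvariant_def)
    ultimately have "earliest k i \<le> earliest k (Suc i)"
      using step by (intro subinvariant_act_le[where A = "C k" and x = "earliest k"]) auto
    then show ?case using step by (auto intro: order_trans)
  qed
  have "0 \<le> earliest k 1" if "1 \<le> k" "k \<le> K" for k
    using that
  proof (induction k rule: dec_induct)
    case base
    have "released 1 1 \<le> earliest 1 1"
      using released_le_earliest[of 1] n_pos by (auto simp: vec_le_def)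
    then show ?case by (simp add: released_1 mat_E_def)
  next
    case (step k)
    have "0 \<le> I k 1 1"
      using flow n_pos step unfolding permutation_flow_shop_def I_mat_def by auto
    moreover have "vec_le n (act (I k) (earliest k)) (earliest (k + 1))"
      using subinvariant_earliest step by (auto simp: subinvariant_def)
    ultimately have "earliest k 1 \<le> earliest (k + 1) 1"
      using n_pos by (intro subinvariant_act_le[where A = "I k" and x = "earliest k"]) auto
    then show ?case using step by (auto intro: order_trans)
  qed
  then show ?thesis using assms(2,3) by (auto intro!: stage[of k i])
qed

text \<open>
  Any competitor \<open>y\<close> may be shifted to start at time 0, which leaves its duration unchanged, and
  is then bounded below by \<open>earliest\<close>.
\<close>

lemma earliest_solves:
  assumes flow: "permutation_flow_shop n K A0 A1 v"
  shows "\<exists>x. makespan_solution n K A0 A1 B0 B1 v x \<and> ereal (duration n K x) = earliest K n"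
proof -
  define x where "x k i = real_of_ereal (earliest k i)" for k i
  have x: "ereal (x k i) = earliest k i" if "k \<in> {1..K}" "i \<in> {1..n}" for k i
    using earliest_fin[OF that] earliest_nonneg[OF flow that]
    by (auto simp: x_def intro!: ereal_real')
  have ends: "1 \<in> {1..n}" "n \<in> {1..n}" "1 \<in> {1..K}" "K \<in> {1..K}"
    using n_pos K_pos by auto
  have feas: "feasible n K A0 A1 B0 B1 v x"
  proof -
    have cong: "vec_le n (act A (\<lambda>i. ereal (x k i))) (\<lambda>i. ereal (x l i))
        \<longleftrightarrow> vec_le n (act A (earliest k)) (earliest l)"
      if "k \<in> {1..K}" "l \<in> {1..K}" for A k l
      using that x by (auto simp: vec_le_def mv_le_iff[OF n_pos])
    have "subinvariant (\<lambda>k i. ereal (x k i)) \<longleftrightarrow> subinvariant earliest"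
      unfolding subinvariant_def by (intro conj_cong ball_cong cong refl) auto
    then show ?thesis using subinvariant_earliest by (simp add: feasible_iff_subinvariant)
  qed
  have lower: "x K n \<le> duration n K y" if "feasible n K A0 A1 B0 B1 v y" for y
  proof -
    let ?y = "\<lambda>k i. y k i - y 1 1"
    have "subinvariant (\<lambda>k i. ereal (?y k i))"
      using feasible_shift[OF that, of "y 1 1"] by (simp add: feasible_iff_subinvariant)
    from earliest_least[OF this] have "earliest K n \<le> ereal (?y K n)"
      using ends by (auto simp: vec_le_def)
    then have "ereal (x K n) \<le> ereal (?y K n)" using x[OF ends(4,2)] by simp
    then show ?thesis by (simp add: duration_def)
  qed
  have "0 \<le> ereal (x 1 1)"
    using earliest_nonneg[OF flow ends(3,1)] x[OF ends(3,1)] by simp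
  \<comment> \<open>The bound \<open>lower\<close>, applied to the earliest schedule itself, excludes \<open>x 1 1 > 0\<close>.\<close>
  then have eq: "duration n K x = x K n"
    using lower[OF feas] by (simp add: duration_def)
  have "makespan_solution n K A0 A1 B0 B1 v x"
    using feas lower by (simp add: makespan_solution_def eq)
  moreover have "ereal (duration n K x) = earliest K n"
    using x[OF ends(4,2)] by (simp add: eq)
  ultimately show ?thesis by blast
qed

end

end

lemma makespan_eq_duration:
  assumes "makespan_solution n K A0 A1 B0 B1 v x"
  shows "makespan n K A0 A1 B0 B1 v = ereal (duration n K x)"
  unfolding makespan_def
  using assms by (intro antisym INF_lower2[of x] INF_greatest) (auto simp: makespan_solution_def)

theorem theorem3:
  fixes n K :: nat
    and \<Sigma> :: "'m set"
    and A0 A1 B0 B1 :: "'m \<Rightarrow> ematrix"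
    and v :: "nat \<Rightarrow> 'm"
  assumes "n \<ge> 1" and "K \<ge> 1"
    and "finite \<Sigma>"
    and "\<And>a i j. a \<in> \<Sigma> \<Longrightarrow> i \<in> {1..n} \<Longrightarrow> j \<in> {1..n} \<Longrightarrow> A0 a i j \<noteq> \<infinity>"
    and "\<And>a i j. a \<in> \<Sigma> \<Longrightarrow> i \<in> {1..n} \<Longrightarrow> j \<in> {1..n} \<Longrightarrow> A1 a i j \<noteq> \<infinity>"
    and "\<And>a i j. a \<in> \<Sigma> \<Longrightarrow> i \<in> {1..n} \<Longrightarrow> j \<in> {1..n} \<Longrightarrow> B0 a i j \<noteq> -\<infinity>"
    and "\<And>a i j. a \<in> \<Sigma> \<Longrightarrow> i \<in> {1..n} \<Longrightarrow> j \<in> {1..n} \<Longrightarrow> B1 a i j \<noteq> -\<infinity>"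
    and "\<And>k. k \<in> {1..K} \<Longrightarrow> v k \<in> \<Sigma>"
    and "permutation_flow_shop n K A0 A1 v"
  shows "((\<exists>x. makespan_solution n K A0 A1 B0 B1 v x) \<longleftrightarrow>
            (\<forall>k\<in>{1..K}. precedence_graph n (C_mat A0 B0 v k) \<in> \<Gamma>) \<and>
            (\<forall>k\<in>{1..K - 1}. precedence_graph n (CC_mat n K A0 A1 B0 B1 v k) \<in> \<Gamma>)) \<and>
         ((\<forall>k\<in>{1..K}. precedence_graph n (C_mat A0 B0 v k) \<in> \<Gamma>) \<and>
            (\<forall>k\<in>{1..K - 1}. precedence_graph n (CC_mat n K A0 A1 B0 B1 v k) \<in> \<Gamma>) \<and>
            K \<ge> 2
          \<longrightarrow> makespan n K A0 A1 B0 B1 v = MM_mat n K A0 A1 B0 B1 v n 1)"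
    (is "(?sol \<longleftrightarrow> ?circ) \<and> _")
proof -
  interpret schedule n K A0 A1 B0 B1 v
    using assms(1,2) by unfold_locales
  have modes: "v k \<in> \<Sigma>" if "k \<in> {1..K} \<or> k \<in> {1..K - 1}" for k
    using that assms(8) by auto
  have C_fin: "C k i j \<noteq> \<infinity>" if "k \<in> {1..K}" "i \<in> {1..n}" "j \<in> {1..n}" for k i j
    using assms(4,6) modes that
    by (auto simp: C_mat_def mat_oplus_def mat_sharp_def max_def ereal_uminus_eq_reorder)
  have I_fin: "I k i j \<noteq> \<infinity>" if "k \<in> {1..K - 1}" "i \<in> {1..n}" "j \<in> {1..n}" for k i j
    using assms(5) modes that by (auto simp: I_mat_def)
  have P_fin: "P k i j \<noteq> \<infinity>" if "k \<in> {1..K - 1}" "i \<in> {1..n}" "j \<in> {1..n}" for k i j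
    using assms(7) modes that by (auto simp: P_mat_def mat_sharp_def ereal_uminus_eq_reorder)
  have necessary: ?circ if ?sol
  proof -
    from that obtain x where "feasible n K A0 A1 B0 B1 v x"
      by (auto simp: makespan_solution_def)
    then have sub: "subinvariant (\<lambda>k i. ereal (x k i))"
      by (simp add: feasible_iff_subinvariant)
    show ?thesis
    proof (intro conjI ballI)
      fix k assume "k \<in> {1..K}"
      then show "precedence_graph n (C k) \<in> \<Gamma>"
        using sub by (intro no_pos_circuitI[OF assms(1), of _ "x k"]) (auto simp: subinvariant_def)
    next
      fix k assume "k \<in> {1..K - 1}"
      then show "precedence_graph n (CC k) \<in> \<Gamma>"
        using act_CC_le[OF sub] by (intro no_pos_circuitI[OF assms(1), of _ "x k"]) auto
    qed
  qed
  have sufficient: "\<exists>x. makespan_solution n K A0 A1 B0 B1 v x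
      \<and> ereal (duration n K x) = earliest K n" if ?circ
    by (rule earliest_solves) (use that C_fin I_fin P_fin assms(9) in blast)+
  have "makespan n K A0 A1 B0 B1 v = MM_mat n K A0 A1 B0 B1 v n 1" if ?circ "K \<ge> 2"
    using sufficient[OF that(1)] makespan_eq_duration earliest_K[OF that(2), of n] assms(1) by force
  with necessary sufficient show ?thesis by blast
qed

end
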